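(* For all $p,\ell\in\mathbb{N}$, the $p$th central moment of $\mathrm{SSCC}$ over all pairs of binary sequences of length $\ell$ (uniformly distributed) is \[ \mu^\ell_{p,(f,g)}\,\mathrm{SSCC}(f,g) = \sum_{\mathfrak{P} \in \mathrm{CIsom}(p)} |\mathfrak{P}|\,\mathrm{CSols}(\mathfrak{P},\ell). \]
   Context: $\mathbb{N}=\{0,1,2,\ldots\}$ and $[n]=\{0,1,\ldots,n-1\}$ for $n\in\mathbb{N}$. Moments. A binary sequence of length $\ell$ is a doubly infinite list $f=(f_j)_{j\in\mathbb{Z}}$ with $f_j\in\{-1,1\}$ for $j\in[\ell]$ and $f_j=0$ otherwise. The aperiodic crosscorrelation of $f$ with $g$ at shift $s\in\mathbb{Z}$ is $C_{f,g}(s)=\sum_{j\in\mathbb{Z}} f_{j+s}\overline{g_j}$, and $\mathrm{SSCC}(f,g)=\sum_{s\in\mathbb{Z}}|C_{f,g}(s)|^2$. $\mathrm{Pair}(\ell)$ is the set of all $2^{2\ell}$ ordered pairs of binary sequences of length $\ell$ with uniform probability measure, $\mathbb{E}^\ell_{(f,g)}$ is expectation with respect to it, and $\mu^\ell_{p,(f,g)} v(f,g)=\mathbb{E}^\ell_{(f,g)}\bigl(v(f,g)-\mathbb{E}^\ell_{(f,g)}v(f,g)\bigr)^p$. Assignments and partitions. Fix $p\in\mathbb{N}$. An assignment for $[p]$ is a function $\tau\colon[p]\times[2]\times[2]\to\mathbb{N}$, with values written $\tau_{e,s,v}$. Partitions have nonempty classes; $\mathrm{Part}(p)$ is the set of all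 partitions of $[p]\times[2]\times[2]$. A partition $\mathcal{P}\in\mathrm{Part}(p)$ is coherent if each of its classes is contained in $[p]\times[2]\times\{0\}$ or in $[p]\times[2]\times\{1\}$; $\mathrm{Coh}(p)$ is the set of coherent partitions in $\mathrm{Part}(p)$. For $\mathcal{P}\in\mathrm{Coh}(p)$: - $\mathrm{CAs}(\mathcal{P})$ is the set of assignments $\tau$ for $[p]$ such that for all $(e,s,v),(e',s',v')\in[p]\times[2]\times[2]$ with $v=v'$, we have $\tau_{e,s,v}=\tau_{e',s',v'}$ if and only if $(e,s,v)$ and $(e',s',v')$ lie in the same class of $\mathcal{P}$; - $\mathrm{CAs}(\mathcal{P},=)$ is the set of $\tau\in\mathrm{CAs}(\mathcal{P})$ with $\tau_{e,0,0}+\tau_{e,0,1}=\tau_{e,1,0}+\tau_{e,1,1}$ for all $e\in[p]$; - $\mathrm{CAs}(\mathcal{P},=,\ell)$ is the set of $\tau\in\mathrm{CAs}(\mathcal{P},=)$ all of whose values lie in $[\ell]$. $\mathcal{P}\in\mathrm{Coh}(p)$ is coherently satisfiable if $\mathrm{CAs}(\mathcal{P},=)\neq\emptyset$; $\mathrm{CSat}(p)$ is the set of such partitions. A partition is even if every class is a finite set of even cardinality. For $e\in[p]$, the restriction $\mathcal{P}_{\{e\}}$ is the partition $\{P\cap(\{e\}\times[2]\times[2]):P\in\mathcal{P}\}\smallsetminus\{\emptyset\}$ of $\{e\}\times[2]\times[2]$. $\mathcal{P}\in\mathrm{Part}(p)$ is globally even, locally odd (GELO) if $\mathcal{P}$ is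 even but $\mathcal{P}_{\{e\}}$ is not even for every $e\in[p]$; $\mathrm{GELO}(p)$ is the set of such partitions. $\mathrm{CCon}(p)=\mathrm{CSat}(p)\cap\mathrm{GELO}(p)$ is the set of coherently contributory partitions. Group action. $S_n$ is the group of permutations of $[n]$. $\Gamma^{(p)}=S_2\times(S_2\wr_{[p]}S_p)$, whose elements $\gamma=(\varphi,((\sigma_0,\ldots,\sigma_{p-1}),\epsilon))$ (with $\varphi,\sigma_0,\ldots,\sigma_{p-1}\in S_2$ and $\epsilon\in S_p$) act on $[p]\times[2]\times[2]$ by $\gamma(e,s,v)=(\epsilon(e),\sigma_{\epsilon(e)}(s),\varphi(v))$, and hence on partitions in $\mathrm{Part}(p)$ by $\gamma(\mathcal{P})=\{\gamma(P):P\in\mathcal{P}\}$. Two partitions in $\mathrm{Part}(p)$ are coherently isomorphic if they lie in the same $\Gamma^{(p)}$-orbit; the coherent isomorphism class of a partition is its orbit. $\mathrm{CCon}(p)$ is a union of such orbits, and $\mathrm{CIsom}(p)$ is the set of coherent isomorphism classes of partitions in $\mathrm{CCon}(p)$. The value $|\mathrm{CAs}(\mathcal{P},=,\ell)|$ is the same for all $\mathcal{P}$ in a given coherent isomorphism class $\mathfrak{P}$ of coherent partitions, and $\mathrm{CSols}(\mathfrak{P},\ell)$ denotes this common value. *)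

theory Defs
  imports "HOL-Probability.Probability" "HOL-Algebra.Group_Action"
begin

text \<open>The initial segment $[n] = \{0,\dots,n-1\}$ is rendered as \<open>{..<n} :: nat set\<close>.\<close>

section \<open>Binary sequences and moments\<close>

definition binary_seqs :: "nat \<Rightarrow> (int \<Rightarrow> complex) set" where
  "binary_seqs l = {f. \<forall>j. if 0 \<le> j \<and> j < int l then f j \<in> {-1, 1} else f j = 0}"

text \<open>On binary sequences the two infinite sums below have finite support, hence always converge.\<close>

definition crosscorr :: "(int \<Rightarrow> complex) \<Rightarrow> (int \<Rightarrow> complex) \<Rightarrow> int \<Rightarrow> complex" where
  "crosscorr f g s = (\<Sum>\<^sub>\<infinity>j\<in>UNIV. f (j + s) * cnj (g j))"

definition SSCC :: "(int \<Rightarrow> complex) \<Rightarrow> (int \<Rightarrow> complex) \<Rightarrow> real" where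
  "SSCC f g = (\<Sum>\<^sub>\<infinity>s\<in>UNIV. (cmod (crosscorr f g s))\<^sup>2)"

definition seq_pairs :: "nat \<Rightarrow> ((int \<Rightarrow> complex) \<times> (int \<Rightarrow> complex)) set" where
  "seq_pairs l = binary_seqs l \<times> binary_seqs l"

definition expect :: "nat \<Rightarrow> ((int \<Rightarrow> complex) \<Rightarrow> (int \<Rightarrow> complex) \<Rightarrow> real) \<Rightarrow> real" where
  "expect l v = measure_pmf.expectation (pmf_of_set (seq_pairs l)) (\<lambda>(f, g). v f g)"

definition central_moment ::
  "nat \<Rightarrow> nat \<Rightarrow> ((int \<Rightarrow> complex) \<Rightarrow> (int \<Rightarrow> complex) \<Rightarrow> real) \<Rightarrow> real" where
  "central_moment p l v = expect l (\<lambda>f g. (v f g - expect l v) ^ p)"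

section \<open>Partitions and assignments\<close>

text \<open>A triple \<open>(e, s, v)\<close> is an element of $[p]\times[2]\times[2]$.\<close>

type_synonym point = "nat \<times> nat \<times> nat"

definition points :: "nat \<Rightarrow> point set" where
  "points p = {..<p} \<times> {..<2} \<times> {..<2}"

definition Partitions :: "nat \<Rightarrow> point set set set" where
  "Partitions p = {\<P>. partition_on (points p) \<P>}"

definition Coh :: "nat \<Rightarrow> point set set set" where
  "Coh p = {\<P> \<in> Partitions p.
     \<forall>P\<in>\<P>. P \<subseteq> {..<p} \<times> {..<2} \<times> {0} \<or> P \<subseteq> {..<p} \<times> {..<2} \<times> {1}}"

text \<open>Assignments are taken to be extensional, so that functions on $[p]\times[2]\times[2]$
  are counted correctly.\<close>

definition assignments :: "nat \<Rightarrow> (point \<Rightarrow> nat) set" where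
  "assignments p = points p \<rightarrow>\<^sub>E UNIV"

definition CAs :: "nat \<Rightarrow> point set set \<Rightarrow> (point \<Rightarrow> nat) set" where
  "CAs p \<P> = {\<tau> \<in> assignments p.
     \<forall>e s v e' s' v'. (e, s, v) \<in> points p \<longrightarrow> (e', s', v') \<in> points p \<longrightarrow> v = v' \<longrightarrow>
       (\<tau> (e, s, v) = \<tau> (e', s', v') \<longleftrightarrow> (\<exists>P\<in>\<P>. (e, s, v) \<in> P \<and> (e', s', v') \<in> P))}"

definition CAs_eq :: "nat \<Rightarrow> point set set \<Rightarrow> (point \<Rightarrow> nat) set" where
  "CAs_eq p \<P> = {\<tau> \<in> CAs p \<P>.
     \<forall>e<p. \<tau> (e, 0, 0) + \<tau> (e, 0, 1) = \<tau> (e, 1, 0) + \<tau> (e, 1, 1)}"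

definition CAs_eq_len :: "nat \<Rightarrow> point set set \<Rightarrow> nat \<Rightarrow> (point \<Rightarrow> nat) set" where
  "CAs_eq_len p \<P> l = {\<tau> \<in> CAs_eq p \<P>. \<forall>x\<in>points p. \<tau> x \<in> {..<l}}"

definition CSat :: "nat \<Rightarrow> point set set set" where
  "CSat p = {\<P> \<in> Coh p. CAs_eq p \<P> \<noteq> {}}"

definition even_partition :: "'a set set \<Rightarrow> bool" where
  "even_partition \<P> \<longleftrightarrow> (\<forall>P\<in>\<P>. finite P \<and> even (card P))"

definition restrict_partition :: "point set set \<Rightarrow> nat \<Rightarrow> point set set" where
  "restrict_partition \<P> e = (\<lambda>P. P \<inter> ({e} \<times> {..<2} \<times> {..<2})) ` \<P> - {{}}"

definition GELO :: "nat \<Rightarrow> point set set set" where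
  "GELO p = {\<P> \<in> Partitions p.
     even_partition \<P> \<and> (\<forall>e<p. \<not> even_partition (restrict_partition \<P> e))}"

definition CCon :: "nat \<Rightarrow> point set set set" where
  "CCon p = CSat p \<inter> GELO p"

section \<open>The group action and coherent isomorphism classes\<close>

definition Sym :: "nat \<Rightarrow> (nat \<Rightarrow> nat) monoid" where
  "Sym n = \<lparr>carrier = {\<pi>. \<pi> permutes {..<n}}, monoid.mult = (\<circ>), one = id\<rparr>"

text \<open>The wreath product $S_2 \wr_{[p]} S_p$, with the multiplication for which
  \<open>(e, s) \<mapsto> (\<epsilon> e, \<sigma> (\<epsilon> e) s)\<close> is a left action.  The
  tuple $(\sigma_0,\dots,\sigma_{p-1})$ is an extensional function on \<open>{..<p}\<close>.\<close>

definition Wreath :: "nat \<Rightarrow> ((nat \<Rightarrow> nat \<Rightarrow> nat) \<times> (nat \<Rightarrow> nat)) monoid" where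
  "Wreath p = \<lparr>carrier = ({..<p} \<rightarrow>\<^sub>E carrier (Sym 2)) \<times> carrier (Sym p),
     monoid.mult = (\<lambda>(\<sigma>, \<epsilon>) (\<sigma>', \<epsilon>').
       (\<lambda>e\<in>{..<p}. \<sigma> e \<circ> \<sigma>' (Hilbert_Choice.inv \<epsilon> e), \<epsilon> \<circ> \<epsilon>')),
     one = (\<lambda>e\<in>{..<p}. id, id)\<rparr>"

type_synonym gamma = "(nat \<Rightarrow> nat) \<times> (nat \<Rightarrow> nat \<Rightarrow> nat) \<times> (nat \<Rightarrow> nat)"

definition Gamma_grp :: "nat \<Rightarrow> gamma monoid" where
  "Gamma_grp p = Sym 2 \<times>\<times> Wreath p"

fun act_point :: "gamma \<Rightarrow> point \<Rightarrow> point" where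
  "act_point (\<phi>, \<sigma>, \<epsilon>) (e, s, v) = (\<epsilon> e, \<sigma> (\<epsilon> e) s, \<phi> v)"

definition act_partition :: "gamma \<Rightarrow> point set set \<Rightarrow> point set set" where
  "act_partition \<gamma> \<P> = (\<lambda>P. act_point \<gamma> ` P) ` \<P>"

definition CIsom :: "nat \<Rightarrow> point set set set set" where
  "CIsom p = (\<lambda>\<P>. orbit (Gamma_grp p) act_partition \<P>) ` CCon p"

text \<open>The common value of \<open>card (CAs_eq_len p \<P> l)\<close> over the class \<open>\<PP>\<close>.\<close>

definition CSols :: "nat \<Rightarrow> point set set set \<Rightarrow> nat \<Rightarrow> nat" where
  "CSols p \<PP> l = (THE n. \<forall>\<P>\<in>\<PP>. card (CAs_eq_len p \<P> l) = n)"

end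

theory Submission
  imports Defs
begin

text \<open>
  \<open>SSCC f g\<close> is the sum, over quadruples $t$ of indices with $t_{0,0}+t_{0,1}=t_{1,0}+t_{1,1}$, of
  the product of four signs of $f$ and $g$; its mean counts the quadruples in which every sign
  occurs an even number of times. Expanding the $p$th power of the centred sum gives one term per
  assignment $\tau$. If some equation $e$ of $\tau$ has all its signs paired, its centred factor is
  identically zero; otherwise the expected product is 1 or 0 according to whether all signs pair up
  globally. So the central moment counts the assignments whose kernel partition is globally even
  and locally odd, and grouping these by the kernel and then by its orbit gives the formula.
\<close>

section \<open>Signs with even fibres\<close>

text \<open>The cancellation is sharper than an average. A quadruple whose signs pair up has a
  monomial equal to 1 on every pair of sequences, and it contributes exactly 1 to the mean. So the
  mean can be subtracted term by term before the pth power is expanded, and one locally even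
  equation kills its whole product pointwise. If no equation is locally even, all subtracted
  constants are 0 and only the global parity of the monomial matters. The index j in f and the same
  j in g name different random signs. This is why occurrences are compared by the pair of v and the
  value, why kernel partitions are coherent, and why \<open>CAs\<close> relates only points with
  equal v. Coherence settles the remaining pairs, so a coherent partition can be recovered from any
  one of its assignments. Averages are treated as finite sums; the independence of the signs enters
  through the involution that negates one of them.\<close>

lemma prod_even_fibres:
  fixes X :: "'k \<Rightarrow> real"
  assumes "finite A" and sq: "\<And>x. x \<in> A \<Longrightarrow> X (\<kappa> x) ^ 2 = 1"
    and ev: "\<And>k. even (card {x \<in> A. \<kappa> x = k})"
  shows "(\<Prod>x\<in>A. X (\<kappa> x)) = 1"
proof -
  \<comment> \<open>Grouped by key, the factors form one even power for each key, and its base has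
    square 1.\<close>
  have "(\<Prod>x\<in>A. X (\<kappa> x)) = (\<Prod>k\<in>\<kappa> ` A. \<Prod>x\<in>{x \<in> A. \<kappa> x = k}. X (\<kappa> x))"
    by (rule prod.image_gen) fact
  also have "\<dots> = (\<Prod>k\<in>\<kappa> ` A. 1)"
  proof (rule prod.cong[OF refl])
    fix k assume "k \<in> \<kappa> ` A"
    then have k: "X k ^ 2 = 1" using sq by auto
    obtain m where m: "card {x \<in> A. \<kappa> x = k} = 2 * m" using ev[of k] by auto
    have "(\<Prod>x\<in>{x \<in> A. \<kappa> x = k}. X (\<kappa> x)) = (\<Prod>x\<in>{x \<in> A. \<kappa> x = k}. X k)"
      by (rule prod.cong) auto
    also have "\<dots> = (X k ^ 2) ^ m" by (simp add: m power_mult)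
    finally show "(\<Prod>x\<in>{x \<in> A. \<kappa> x = k}. X (\<kappa> x)) = 1" by (simp add: k)
  qed
  finally show ?thesis by simp
qed

text \<open>\<open>F\<close> negates the sign named \<open>k\<close>, which occurs an odd number of
  times, so every product changes sign while the sum is merely reindexed. The sum therefore equals
  its own negative.\<close>

lemma sum_prod_odd_fibre:
  fixes X :: "'w \<Rightarrow> 'k \<Rightarrow> real"
  assumes "finite A" and odd: "odd (card {x \<in> A. \<kappa> x = k})"
    and F: "\<And>w. w \<in> \<Omega> \<Longrightarrow> F w \<in> \<Omega>" "\<And>w. w \<in> \<Omega> \<Longrightarrow> F (F w) = w"
    and X: "\<And>w x. w \<in> \<Omega> \<Longrightarrow> x \<in> A \<Longrightarrow>
              X (F w) (\<kappa> x) = (if \<kappa> x = k then - X w (\<kappa> x) else X w (\<kappa> x))"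
  shows "(\<Sum>w\<in>\<Omega>. \<Prod>x\<in>A. X w (\<kappa> x)) = 0"
proof -
  let ?S = "\<Sum>w\<in>\<Omega>. \<Prod>x\<in>A. X w (\<kappa> x)"
  have "?S = (\<Sum>w\<in>\<Omega>. \<Prod>x\<in>A. X (F w) (\<kappa> x))"
    by (rule sum.reindex_bij_witness[of _ F F]) (auto simp: F)
  also have "\<dots> = (\<Sum>w\<in>\<Omega>. - (\<Prod>x\<in>A. X w (\<kappa> x)))"
  proof (rule sum.cong[OF refl])
    fix w assume w: "w \<in> \<Omega>"
    have "(\<Prod>x\<in>A. X (F w) (\<kappa> x)) = (\<Prod>x\<in>A. (if \<kappa> x = k then -1 else 1) * X w (\<kappa> x))"
      by (rule prod.cong) (auto simp: X w)
    also have "\<dots> = (\<Prod>x\<in>A. if \<kappa> x = k then -1 else 1) * (\<Prod>x\<in>A. X w (\<kappa> x))"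
      by (rule prod.distrib)
    also have "(\<Prod>x\<in>A. if \<kappa> x = k then -1 else 1 :: real) = (-1) ^ card {x \<in> A. \<kappa> x = k}"
      using \<open>finite A\<close> by (simp flip: prod.inter_filter)
    finally show "(\<Prod>x\<in>A. X (F w) (\<kappa> x)) = - (\<Prod>x\<in>A. X w (\<kappa> x))"
      using odd by simp
  qed
  also have "\<dots> = - ?S" by (rule sum_negf)
  finally show ?thesis by simp
qed

section \<open>Pairs of binary sequences\<close>

lemma finite_binary_seqs: "finite (binary_seqs l)"
proof -
  have "finite {f. \<forall>j::int. (j \<in> {0..<int l} \<longrightarrow> f j \<in> {-1, 1::complex}) \<and>
                            (j \<notin> {0..<int l} \<longrightarrow> f j = 0)}"
    by (rule finite_set_of_finite_funs) auto
  then show ?thesis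
    by (rule finite_subset[rotated]) (auto simp: binary_seqs_def split: if_splits)
qed

lemma binary_seqs_nonempty: "binary_seqs l \<noteq> {}"
proof -
  have "(\<lambda>j. if 0 \<le> j \<and> j < int l then 1 else 0) \<in> binary_seqs l"
    by (auto simp: binary_seqs_def)
  then show ?thesis by blast
qed

lemma finite_seq_pairs: "finite (seq_pairs l)" and seq_pairs_nonempty: "seq_pairs l \<noteq> {}"
  by (auto simp: seq_pairs_def finite_binary_seqs binary_seqs_nonempty)

lemma card_seq_pairs_pos: "card (seq_pairs l) > 0"
  using finite_seq_pairs seq_pairs_nonempty by (simp add: card_gt_0_iff)

lemma expect_eq_sum: "expect l v = (\<Sum>(f, g)\<in>seq_pairs l. v f g) / card (seq_pairs l)"
  unfolding expect_def by (rule integral_pmf_of_set[OF seq_pairs_nonempty finite_seq_pairs])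

text \<open>A pair \<open>(v, j)\<close> names one random sign, with v = 0 for f and v = 1 for g.
  Entries of binary sequences are real, so \<open>Re\<close> loses nothing and keeps the monomials
  real-valued.\<close>

fun letter :: "(int \<Rightarrow> complex) \<times> (int \<Rightarrow> complex) \<Rightarrow> nat \<times> nat \<Rightarrow> real" where
  "letter (f, g) (v, j) = Re ((if v = 0 then f else g) (int j))"

fun flip :: "nat \<times> nat \<Rightarrow> (int \<Rightarrow> complex) \<times> (int \<Rightarrow> complex) \<Rightarrow> (int \<Rightarrow> complex) \<times> (int \<Rightarrow> complex)"
  where
  "flip (v, j) (f, g) =
     (if v = 0 then (f(int j := - f (int j)), g) else (f, g(int j := - g (int j))))"

lemma binary_seqs_flip:
  assumes "f \<in> binary_seqs l"
  shows "f(i := - f i) \<in> binary_seqs l"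
proof -
  have *: "if 0 \<le> j \<and> j < int l then f j \<in> {-1, 1} else f j = 0" for j
    using assms unfolding binary_seqs_def by blast
  have "if 0 \<le> j \<and> j < int l then (f(i := - f i)) j \<in> {-1, 1} else (f(i := - f i)) j = 0" for j
    using *[of j] by (auto split: if_splits)
  then show ?thesis unfolding binary_seqs_def by blast
qed

lemma letter_square:
  assumes "\<omega> \<in> seq_pairs l" "j < l"
  shows "letter \<omega> (v, j) ^ 2 = 1"
proof -
  obtain f g where w: "\<omega> = (f, g)" by force
  have "f (int j) \<in> {-1, 1}" "g (int j) \<in> {-1, 1}"
    using assms unfolding w seq_pairs_def binary_seqs_def by (auto split: if_splits)
  then show ?thesis by (auto simp: w)
qed

lemma letter_flip:
  "v < 2 \<Longrightarrow> v' < 2 \<Longrightarrow>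
    letter (flip (v, j) \<omega>) (v', j') =
      (if (v', j') = (v, j) then - letter \<omega> (v', j') else letter \<omega> (v', j'))"
  by (cases \<omega>) auto

text \<open>Orthogonality of monomials in independent uniform signs, scaled by the number of pairs
  to avoid division. If some key occurs an odd number of times, the involution is
  \<open>flip\<close> at that key.\<close>

lemma sum_prod_letter:
  assumes "finite A" and \<kappa>: "\<And>x. x \<in> A \<Longrightarrow> \<kappa> x \<in> {..<2} \<times> {..<l}"
  shows "(\<Sum>\<omega>\<in>seq_pairs l. \<Prod>x\<in>A. letter \<omega> (\<kappa> x)) =
         of_bool (\<forall>k. even (card {x \<in> A. \<kappa> x = k})) * real (card (seq_pairs l))"
proof (cases "\<forall>k. even (card {x \<in> A. \<kappa> x = k})")
  case True
  have "(\<Prod>x\<in>A. letter \<omega> (\<kappa> x)) = 1" if "\<omega> \<in> seq_pairs l" for \<omega>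
  proof (rule prod_even_fibres[where X = "letter \<omega>"])
    fix x assume "x \<in> A"
    then show "letter \<omega> (\<kappa> x) ^ 2 = 1"
      using letter_square[OF that] \<kappa>[of x] by (cases "\<kappa> x") auto
  qed (use True assms in auto)
  then show ?thesis using True by simp
next
  case False
  then obtain k where k: "odd (card {x \<in> A. \<kappa> x = k})" by blast
  then obtain y where y: "y \<in> A" "\<kappa> y = k"
    by (metis (mono_tags, lifting) card.empty empty_Collect_eq even_zero)
  obtain v j where vj: "k = (v, j)" by force
  then have v2: "v < 2" using \<kappa>[OF y(1)] y(2) by auto
  have "(\<Sum>\<omega>\<in>seq_pairs l. \<Prod>x\<in>A. letter \<omega> (\<kappa> x)) = 0"
  proof (rule sum_prod_odd_fibre[OF assms(1) k, where X = letter and F = "flip k"])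
    fix \<omega> assume "\<omega> \<in> seq_pairs l"
    then show "flip k \<omega> \<in> seq_pairs l" "flip k (flip k \<omega>) = \<omega>"
      by (cases \<omega>; auto simp: vj seq_pairs_def binary_seqs_flip)+
  next
    fix \<omega> x assume "x \<in> A"
    then show "letter (flip k \<omega>) (\<kappa> x) =
        (if \<kappa> x = k then - letter \<omega> (\<kappa> x) else letter \<omega> (\<kappa> x))"
      using letter_flip[OF v2, of "fst (\<kappa> x)" j \<omega> "snd (\<kappa> x)"] \<kappa>[of x]
      by (cases "\<kappa> x") (auto simp: vj)
  qed
  then show ?thesis using False by simp
qed

section \<open>Expanding SSCC\<close>

abbreviation sides :: "(nat \<times> nat) set" where "sides \<equiv> {..<2} \<times> {..<2}"

definition quads :: "nat \<Rightarrow> (nat \<times> nat \<Rightarrow> nat) set" where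
  "quads l = {t \<in> sides \<rightarrow>\<^sub>E {..<l}. t (0, 0) + t (0, 1) = t (1, 0) + t (1, 1)}"

lemma sides_eq: "sides = {(0, 0), (0, 1), (1, 0), (1, 1)}"
  by (auto simp: less_2_cases_iff)

lemma finite_quads: "finite (quads l)"
  by (rule finite_subset[of _ "sides \<rightarrow>\<^sub>E {..<l}"]) (auto simp: quads_def intro!: finite_PiE)

text \<open>A quadruple \<open>t\<close> stands for the term with shift \<open>t (0, 0) - t (1, 1) = t (1, 0) - t (0, 1)\<close>.\<close>

lemma SSCC_eq_sum_quads:
  assumes fg: "f \<in> binary_seqs l" "g \<in> binary_seqs l"
  shows "SSCC f g = (\<Sum>t\<in>quads l. \<Prod>y\<in>sides. letter (f, g) (snd y, t y))"
proof -
  define F where "F j = Re (f j)" for j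
  define G where "G j = Re (g j)" for j
  have f: "f j = of_real (F j)" and g: "g j = of_real (G j)" for j
    using fg unfolding binary_seqs_def F_def G_def
    by (auto simp: complex_eq_iff dest!: spec[of _ j] split: if_splits)
  have F0: "F j = 0" if "j \<notin> {0..<int l}" for j
    using fg(1) that unfolding binary_seqs_def F_def by (auto dest!: spec[of _ j])
  have G0: "G j = 0" if "j \<notin> {0..<int l}" for j
    using fg(2) that unfolding binary_seqs_def G_def by (auto dest!: spec[of _ j])
  define I where "I = {0..<int l}"
  \<comment> \<open>For a shift outside this window, j in \<open>I\<close> forces j + s out of the
    support. The two end points contribute only zeros.\<close>
  define S where "S = {- int l..int l}"
  have fin: "finite I" "finite S" by (auto simp: I_def S_def)
  have C: "crosscorr f g s = of_real (\<Sum>j\<in>I. F (j + s) * G j)" for s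
  proof -
    have "crosscorr f g s = (\<Sum>\<^sub>\<infinity>j\<in>I. f (j + s) * cnj (g j))"
      unfolding crosscorr_def by (rule infsum_cong_neutral) (auto simp: g G0 I_def)
    then show ?thesis by (simp add: fin f g)
  qed
  have C0: "crosscorr f g s = 0" if "s \<notin> S" for s
  proof -
    have "F (j + s) * G j = 0" if "j \<in> I" for j
      using that \<open>s \<notin> S\<close> F0[of "j + s"] by (auto simp: I_def S_def)
    then show ?thesis unfolding C by (simp add: sum.neutral)
  qed
  have "SSCC f g = (\<Sum>\<^sub>\<infinity>s\<in>S. (cmod (crosscorr f g s))\<^sup>2)"
    unfolding SSCC_def by (rule infsum_cong_neutral) (auto simp: C0)
  also have "\<dots> = (\<Sum>s\<in>S. (\<Sum>j\<in>I. F (j + s) * G j)\<^sup>2)"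
    unfolding C norm_of_real by (simp add: fin)
  also have "\<dots> = (\<Sum>(s, j, k)\<in>S \<times> I \<times> I. F (j + s) * G j * (F (k + s) * G k))"
    by (simp add: power2_eq_square sum_product sum.cartesian_product)
  also have "\<dots> = (\<Sum>t\<in>quads l. F (int (t (0, 0))) * G (int (t (1, 1))) *
                     (F (int (t (1, 0))) * G (int (t (0, 1)))))"
  proof -
    \<comment> \<open>On \<open>N\<close> a factor \<open>F\<close> is evaluated off its support and
      the term vanishes. What remains is in bijection with \<open>quads l\<close>.\<close>
    define N where "N = {(s, j, k) \<in> S \<times> I \<times> I. j + s \<notin> I \<or> k + s \<notin> I}"
    \<comment> \<open>The positions of g are crossed: j + s shares a side with k, and k + s with j.
      Both sides then sum to j + k + s, which turns equality of the two shifts into the defining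
      equation of \<open>quads\<close>.\<close>
    define dec :: "int \<times> int \<times> int \<Rightarrow> nat \<times> nat \<Rightarrow> nat" where
      "dec = (\<lambda>(s, j, k). \<lambda>y\<in>sides. if y = (0, 0) then nat (j + s) else if y = (0, 1) then nat k
                 else if y = (1, 0) then nat (k + s) else nat j)"
    define enc :: "(nat \<times> nat \<Rightarrow> nat) \<Rightarrow> int \<times> int \<times> int" where
      "enc t = (int (t (0, 0)) - int (t (1, 1)), int (t (1, 1)), int (t (0, 1)))" for t
    have tl: "t y < l" if "t \<in> quads l" "y \<in> sides" for t y
      using that by (auto simp: quads_def)
    have "(\<Sum>(s, j, k)\<in>S \<times> I \<times> I. F (j + s) * G j * (F (k + s) * G k)) =
          (\<Sum>(s, j, k)\<in>S \<times> I \<times> I - N. F (j + s) * G j * (F (k + s) * G k))"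
      by (rule sum.mono_neutral_right) (use F0 in \<open>auto simp: N_def I_def S_def\<close>)
    also have "\<dots> = (\<Sum>t\<in>quads l. F (int (t (0, 0))) * G (int (t (1, 1))) *
                     (F (int (t (1, 0))) * G (int (t (0, 1)))))"
    proof (rule sum.reindex_bij_witness[where i = enc and j = dec])
      fix a assume a: "a \<in> S \<times> I \<times> I - N"
      obtain s j k where sjk: "a = (s, j, k)" by (cases a)
      show "enc (dec a) = a" "dec a \<in> quads l"
        using a by (auto simp: sjk enc_def dec_def quads_def N_def I_def)
      show "F (int (dec a (0, 0))) * G (int (dec a (1, 1))) *
              (F (int (dec a (1, 0))) * G (int (dec a (0, 1)))) =
            (case a of (s, j, k) \<Rightarrow> F (j + s) * G j * (F (k + s) * G k))"
        using a by (auto simp: sjk dec_def N_def I_def)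
    next
      fix t assume t: "t \<in> quads l"
      then have e: "t (0, 0) + t (0, 1) = t (1, 0) + t (1, 1)" and x: "t \<in> extensional sides"
        by (auto simp: quads_def PiE_def)
      show "dec (enc t) = t"
      proof (rule extensionalityI[OF _ x])
        show "dec (enc t) \<in> extensional sides" by (simp add: dec_def enc_def)
        fix y assume "y \<in> sides"
        then have "y \<in> {(0, 0), (0, 1), (1, 0), (1, 1)}" by (simp add: sides_eq)
        then show "dec (enc t) y = t y" using e by (auto simp: dec_def enc_def)
      qed
      have "t (0, 0) < l" "t (0, 1) < l" "t (1, 0) < l" "t (1, 1) < l"
        by (auto intro!: tl[OF t])
      then show "enc t \<in> S \<times> I \<times> I - N"
        using e by (auto simp: enc_def N_def S_def I_def)
    qed
    finally show ?thesis .
  qed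
  also have "\<dots> = (\<Sum>t\<in>quads l. \<Prod>y\<in>sides. letter (f, g) (snd y, t y))"
    unfolding sides_eq by (simp add: F_def G_def mult_ac)
  finally show ?thesis .
qed

section \<open>The central moment counts assignments\<close>

text \<open>The name of the sign that \<tau> places at x. Including v keeps equal indices in f and
  in g apart.\<close>

definition key :: "(point \<Rightarrow> nat) \<Rightarrow> point \<Rightarrow> nat \<times> nat" where
  "key \<tau> x = (snd (snd x), \<tau> x)"

definition kernel_partition :: "nat \<Rightarrow> (point \<Rightarrow> nat) \<Rightarrow> point set set" where
  "kernel_partition p \<tau> = (\<lambda>x. {y \<in> points p. key \<tau> y = key \<tau> x}) ` points p"

definition solutions :: "nat \<Rightarrow> nat \<Rightarrow> (point \<Rightarrow> nat) set" where
  "solutions p l = {\<tau> \<in> points p \<rightarrow>\<^sub>E {..<l}.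
     \<forall>e<p. \<tau> (e, 0, 0) + \<tau> (e, 0, 1) = \<tau> (e, 1, 0) + \<tau> (e, 1, 1)}"

lemma finite_points: "finite (points p)"
  by (simp add: points_def)

lemma finite_solutions: "finite (solutions p l)"
  by (rule finite_subset[of _ "points p \<rightarrow>\<^sub>E {..<l}"])
    (auto simp: solutions_def finite_points intro!: finite_PiE)

section \<open>Global and local parity of kernel classes\<close>

lemma even_kernel_partition_iff:
  "even_partition (kernel_partition p \<tau>) \<longleftrightarrow> (\<forall>k. even (card {x \<in> points p. key \<tau> x = k}))"
proof
  assume ev: "even_partition (kernel_partition p \<tau>)"
  show "\<forall>k. even (card {x \<in> points p. key \<tau> x = k})"
  proof
    fix k
    show "even (card {x \<in> points p. key \<tau> x = k})"
    proof (cases "k \<in> key \<tau> ` points p")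
      case True
      then show ?thesis using ev by (auto simp: even_partition_def kernel_partition_def)
    next
      \<comment> \<open>A key that is never attained has an empty fibre, of even size. Hence the
        condition may range over all keys, as it does in \<open>sum_prod_letter\<close>.\<close>
      case False
      then have "{x \<in> points p. key \<tau> x = k} = {}" by blast
      then show ?thesis by (simp only: card.empty even_zero)
    qed
  qed
qed (simp add: even_partition_def kernel_partition_def finite_points del: split_paired_All)

text \<open>The empty traces removed by \<open>restrict_partition\<close> have even size 0, so they
  may be put back; finiteness is automatic because a block has four points.\<close>

lemma even_restrict_partition_iff:
  "even_partition (restrict_partition \<P> e) \<longleftrightarrow>
     (\<forall>P\<in>\<P>. even (card (P \<inter> ({e} \<times> sides))))"
proof -
  have "even_partition (restrict_partition \<P> e) \<longleftrightarrow>
      (\<forall>P\<in>\<P>. P \<inter> ({e} \<times> sides) \<noteq> {} \<longrightarrow> even (card (P \<inter> ({e} \<times> sides))))"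
    unfolding even_partition_def restrict_partition_def by auto
  also have "\<dots> \<longleftrightarrow> (\<forall>P\<in>\<P>. even (card (P \<inter> ({e} \<times> sides))))"
    by (rule ball_cong[OF refl]) fastforce
  finally show ?thesis .
qed

lemma card_restrict_fibre:
  assumes "e < p"
  shows "card ({x \<in> points p. key \<tau> x = k} \<inter> ({e} \<times> sides)) =
         card {y \<in> sides. (snd y, \<tau> (e, y)) = k}"
proof -
  have "{x \<in> points p. key \<tau> x = k} \<inter> ({e} \<times> sides) = Pair e ` {y \<in> sides. (snd y, \<tau> (e, y)) = k}"
    using assms by (auto simp: points_def key_def)
  then show ?thesis by (simp add: card_image inj_on_def)
qed

text \<open>Moves the parity test from block e to \<open>sides\<close> along y \<mapsto> (e, y),
  where it becomes the parity condition on the monomial of a single quadruple.\<close>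

lemma even_restrict_kernel_partition_iff:
  assumes "e < p"
  shows "even_partition (restrict_partition (kernel_partition p \<tau>) e) \<longleftrightarrow>
         (\<forall>k. even (card {y \<in> sides. (snd y, \<tau> (e, y)) = k}))"
proof -
  have "even (card {y \<in> sides. (snd y, \<tau> (e, y)) = k})"
    if "even_partition (restrict_partition (kernel_partition p \<tau>) e)" for k
  proof (cases "k \<in> key \<tau> ` points p")
    case True
    then have "{x \<in> points p. key \<tau> x = k} \<in> kernel_partition p \<tau>"
      by (auto simp: kernel_partition_def)
    then show ?thesis
      using that card_restrict_fibre[OF assms, of \<tau> k] unfolding even_restrict_partition_iff
      by (metis (no_types, lifting))
  next
    case False
    then have none: "{x \<in> points p. key \<tau> x = k} = {}" by blast
    show ?thesis
      unfolding card_restrict_fibre[OF assms, symmetric] none by simp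
  qed
  moreover have "even_partition (restrict_partition (kernel_partition p \<tau>) e)"
    if "\<forall>k. even (card {y \<in> sides. (snd y, \<tau> (e, y)) = k})"
    unfolding even_restrict_partition_iff kernel_partition_def
  proof
    fix P assume "P \<in> (\<lambda>x. {y \<in> points p. key \<tau> y = key \<tau> x}) ` points p"
    then obtain k where "P = {y \<in> points p. key \<tau> y = k}" by blast
    then show "even (card (P \<inter> ({e} \<times> sides)))"
      using that by (simp only: card_restrict_fibre[OF assms])
  qed
  ultimately show ?thesis by blast
qed

lemma kernel_partition_partition: "kernel_partition p \<tau> \<in> Partitions p"
  unfolding Partitions_def kernel_partition_def
proof (intro CollectI partition_onI)
  fix P Q
  assume "P \<in> (\<lambda>x. {y \<in> points p. key \<tau> y = key \<tau> x}) ` points p"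
    "Q \<in> (\<lambda>x. {y \<in> points p. key \<tau> y = key \<tau> x}) ` points p" "P \<noteq> Q"
  then obtain x x' where "P = {y \<in> points p. key \<tau> y = key \<tau> x}"
    "Q = {y \<in> points p. key \<tau> y = key \<tau> x'}" "key \<tau> x \<noteq> key \<tau> x'"
    by force
  then show "disjnt P Q" by (auto simp: disjnt_def)
qed blast+

text \<open>Distributivity expands the power over p-tuples \<open>T\<close> of quadruples. Currying,
  T e y = \<tau> (e, y), identifies these with solutions; the restrictions make the two translations
  mutually inverse on extensional functions.\<close>

lemma power_sum_quads:
  fixes b :: "(nat \<times> nat \<Rightarrow> nat) \<Rightarrow> real"
  shows "(\<Sum>t\<in>quads l. b t) ^ p =
         (\<Sum>\<tau>\<in>solutions p l. \<Prod>e<p. b (\<lambda>y\<in>sides. \<tau> (e, y)))"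
proof -
  have "(\<Sum>t\<in>quads l. b t) ^ p = (\<Prod>e<p. \<Sum>t\<in>quads l. b t)" by simp
  also have "\<dots> = (\<Sum>T\<in>{..<p} \<rightarrow>\<^sub>E quads l. \<Prod>e<p. b (T e))"
    by (rule prod_sum_PiE) (auto simp: finite_quads)
  also have "\<dots> = (\<Sum>\<tau>\<in>solutions p l. \<Prod>e<p. b (\<lambda>y\<in>sides. \<tau> (e, y)))"
  proof (rule sum.reindex_bij_witness[where
        i = "\<lambda>\<tau>. \<lambda>e\<in>{..<p}. \<lambda>y\<in>sides. \<tau> (e, y)" and
        j = "\<lambda>T. \<lambda>x\<in>points p. T (fst x) (snd x)"])
    fix T assume T: "T \<in> {..<p} \<rightarrow>\<^sub>E quads l"
    then have Te: "T e \<in> quads l" if "e < p" for e using that by auto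
    have *: "(\<lambda>y\<in>sides. (\<lambda>x\<in>points p. T (fst x) (snd x)) (e, y)) = T e" if "e < p" for e
    proof -
      have "T e \<in> extensional sides" using Te[OF that] by (auto simp: quads_def PiE_def)
      then show ?thesis
        by (intro extensionalityI[of _ sides]) (use that in \<open>auto simp: points_def\<close>)
    qed
    show "(\<lambda>e\<in>{..<p}. \<lambda>y\<in>sides. (\<lambda>x\<in>points p. T (fst x) (snd x)) (e, y)) = T"
      by (rule extensionalityI[of _ "{..<p}"]) (use T * in \<open>auto simp: PiE_def\<close>)
    show "(\<lambda>x\<in>points p. T (fst x) (snd x)) \<in> solutions p l"
      using Te by (fastforce simp: solutions_def quads_def points_def PiE_iff)
    show "(\<Prod>e<p. b (\<lambda>y\<in>sides. (\<lambda>x\<in>points p. T (fst x) (snd x)) (e, y))) = (\<Prod>e<p. b (T e))"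
      using * by (intro prod.cong) auto
  next
    fix \<tau> assume \<tau>: "\<tau> \<in> solutions p l"
    show "(\<lambda>x\<in>points p. (\<lambda>e\<in>{..<p}. \<lambda>y\<in>sides. \<tau> (e, y)) (fst x) (snd x)) = \<tau>"
      by (rule extensionalityI[of _ "points p"])
        (use \<tau> in \<open>auto simp: solutions_def PiE_def points_def\<close>)
    show "(\<lambda>e\<in>{..<p}. \<lambda>y\<in>sides. \<tau> (e, y)) \<in> {..<p} \<rightarrow>\<^sub>E quads l"
      using \<tau> by (auto simp: solutions_def quads_def points_def PiE_iff)
  qed
  finally show ?thesis .
qed

lemma solutions_less: "\<tau> \<in> solutions p l \<Longrightarrow> x \<in> points p \<Longrightarrow> \<tau> x < l"
  by (auto simp: solutions_def)

lemma central_moment_eq_card: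
  "central_moment p l SSCC = card {\<tau> \<in> solutions p l. kernel_partition p \<tau> \<in> GELO p}"
proof -
  define m where "m \<omega> t = (\<Prod>y\<in>sides. letter \<omega> (snd y, t y))" for \<omega> and t :: "nat \<times> nat \<Rightarrow> nat"
  define ev :: "(nat \<times> nat \<Rightarrow> nat) \<Rightarrow> bool"
    where "ev t \<longleftrightarrow> (\<forall>k. even (card {y \<in> sides. (snd y, t y) = k}))" for t
  let ?n = "real (card (seq_pairs l))"
  have n: "?n \<noteq> 0" using card_seq_pairs_pos[of l] by simp
  have sscc: "SSCC f g = (\<Sum>t\<in>quads l. m (f, g) t)" if "(f, g) \<in> seq_pairs l" for f g
    using that SSCC_eq_sum_quads[of f l g] by (auto simp: seq_pairs_def m_def)
  have sum_m: "(\<Sum>\<omega>\<in>seq_pairs l. m \<omega> t) = of_bool (ev t) * ?n" if "t \<in> quads l" for t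
    unfolding m_def ev_def
  proof (rule sum_prod_letter[where A = sides and \<kappa> = "\<lambda>y. (snd y, t y)"])
    fix y :: "nat \<times> nat" assume y: "y \<in> sides"
    have "t y < l" using that y by (auto simp: quads_def)
    then show "(snd y, t y) \<in> {..<2} \<times> {..<l}" using y by (simp add: mem_Times_iff)
  qed simp
  have "(\<Sum>(f, g)\<in>seq_pairs l. SSCC f g) = (\<Sum>\<omega>\<in>seq_pairs l. \<Sum>t\<in>quads l. m \<omega> t)"
    by (rule sum.cong) (auto simp: sscc)
  also have "\<dots> = (\<Sum>t\<in>quads l. \<Sum>\<omega>\<in>seq_pairs l. m \<omega> t)" by (rule sum.swap)
  also have "\<dots> = (\<Sum>t\<in>quads l. of_bool (ev t)) * ?n"
    unfolding sum_distrib_right by (rule sum.cong) (auto simp: sum_m)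
  finally have mean: "expect l SSCC = (\<Sum>t\<in>quads l. of_bool (ev t))"
    unfolding expect_eq_sum using n by simp
  \<comment> \<open>The restriction makes the e-th quadruple extensional, as membership in
    \<open>quads\<close> demands.\<close>
  define r :: "(point \<Rightarrow> nat) \<Rightarrow> nat \<Rightarrow> nat \<times> nat \<Rightarrow> nat"
    where "r \<tau> e = (\<lambda>y\<in>sides. \<tau> (e, y))" for \<tau> e
  have r: "r \<tau> e \<in> quads l" if "\<tau> \<in> solutions p l" "e < p" for \<tau> e
    using that by (auto simp: r_def quads_def solutions_def points_def)
  have ev_r: "ev (r \<tau> e) \<longleftrightarrow> even_partition (restrict_partition (kernel_partition p \<tau>) e)"
    if "e < p" for \<tau> e
  proof -
    have "{y \<in> sides. (snd y, r \<tau> e y) = k} = {y \<in> sides. (snd y, \<tau> (e, y)) = k}" for k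
      by (auto simp: r_def)
    then show ?thesis unfolding ev_def even_restrict_kernel_partition_iff[OF that] by simp
  qed
  have moment: "(\<Sum>\<omega>\<in>seq_pairs l. \<Prod>e<p. m \<omega> (r \<tau> e) - of_bool (ev (r \<tau> e))) =
      of_bool (kernel_partition p \<tau> \<in> GELO p) * ?n" if \<tau>: "\<tau> \<in> solutions p l" for \<tau>
  proof (cases "\<exists>e<p. ev (r \<tau> e)")
    case True
    then obtain e where e: "e < p" "ev (r \<tau> e)" by blast
    have "m \<omega> (r \<tau> e) = 1" if "\<omega> \<in> seq_pairs l" for \<omega>
      unfolding m_def
    proof (rule prod_even_fibres[where X = "letter \<omega>"])
      fix y :: "nat \<times> nat" assume "y \<in> sides"
      then have "r \<tau> e y < l" using r[OF \<tau> e(1)] by (auto simp: quads_def)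
      then show "letter \<omega> (snd y, r \<tau> e y) ^ 2 = 1" by (rule letter_square[OF that])
    qed (use e in \<open>auto simp: ev_def\<close>)
    \<comment> \<open>The factor belonging to e is 1 - 1.\<close>
    then have "(\<Prod>e<p. m \<omega> (r \<tau> e) - of_bool (ev (r \<tau> e))) = 0" if "\<omega> \<in> seq_pairs l" for \<omega>
      using that e by (intro prod_zero bexI[of _ e]) auto
    moreover have "kernel_partition p \<tau> \<notin> GELO p"
      using e ev_r by (auto simp: GELO_def)
    ultimately show ?thesis by (simp add: sum.neutral del: prod_zero_iff)
  next
    case False
    have "(\<Prod>e<p. m \<omega> (r \<tau> e) - of_bool (ev (r \<tau> e))) = (\<Prod>x\<in>points p. letter \<omega> (key \<tau> x))" for \<omega>
    proof -
      have "(\<Prod>e<p. m \<omega> (r \<tau> e) - of_bool (ev (r \<tau> e))) =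
            (\<Prod>e<p. \<Prod>y\<in>sides. letter \<omega> (key \<tau> (e, y)))"
      proof (rule prod.cong[OF refl])
        fix e assume "e \<in> {..<p}"
        then have "\<not> ev (r \<tau> e)" using False by blast
        moreover have "m \<omega> (r \<tau> e) = (\<Prod>y\<in>sides. letter \<omega> (key \<tau> (e, y)))"
          unfolding m_def by (rule prod.cong[OF refl]) (simp add: r_def key_def)
        ultimately show "m \<omega> (r \<tau> e) - of_bool (ev (r \<tau> e)) = (\<Prod>y\<in>sides. letter \<omega> (key \<tau> (e, y)))"
          by simp
      qed
      also have "\<dots> = (\<Prod>x\<in>points p. letter \<omega> (key \<tau> x))"
        unfolding prod.cartesian_product points_def by (simp only: case_prod_unfold prod.collapse)
      finally show ?thesis .
    qed
    moreover have "(\<Sum>\<omega>\<in>seq_pairs l. \<Prod>x\<in>points p. letter \<omega> (key \<tau> x)) =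
        of_bool (\<forall>k. even (card {x \<in> points p. key \<tau> x = k})) * ?n"
    proof (rule sum_prod_letter[OF finite_points])
      fix x assume "x \<in> points p"
      then show "key \<tau> x \<in> {..<2} \<times> {..<l}"
        using solutions_less[OF \<tau>, of x] by (auto simp: key_def points_def)
    qed
    moreover have "kernel_partition p \<tau> \<in> GELO p \<longleftrightarrow> even_partition (kernel_partition p \<tau>)"
      using False ev_r by (auto simp: GELO_def kernel_partition_partition)
    ultimately show ?thesis by (simp add: even_kernel_partition_iff)
  qed
  have "(\<Sum>(f, g)\<in>seq_pairs l. (SSCC f g - expect l SSCC) ^ p) =
        (\<Sum>\<omega>\<in>seq_pairs l. \<Sum>\<tau>\<in>solutions p l. \<Prod>e<p. m \<omega> (r \<tau> e) - of_bool (ev (r \<tau> e)))"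
  proof (rule sum.cong[OF refl])
    fix \<omega> assume w: "\<omega> \<in> seq_pairs l"
    obtain f g where fg: "\<omega> = (f, g)" by force
    have "SSCC f g - expect l SSCC = (\<Sum>t\<in>quads l. m \<omega> t - of_bool (ev t))"
      using w unfolding mean fg by (simp only: sscc sum_subtractf)
    then show "(case \<omega> of (f, g) \<Rightarrow> (SSCC f g - expect l SSCC) ^ p) =
        (\<Sum>\<tau>\<in>solutions p l. \<Prod>e<p. m \<omega> (r \<tau> e) - of_bool (ev (r \<tau> e)))"
      unfolding r_def using power_sum_quads[of "\<lambda>t. m \<omega> t - of_bool (ev t)" l p] by (simp add: fg)
  qed
  also have "\<dots> = (\<Sum>\<tau>\<in>solutions p l. of_bool (kernel_partition p \<tau> \<in> GELO p)) * ?n"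
    unfolding sum_distrib_right by (subst sum.swap) (rule sum.cong[OF refl moment])
  finally show ?thesis
    unfolding central_moment_def expect_eq_sum[of l "\<lambda>f g. (SSCC f g - expect l SSCC) ^ p"]
    using n finite_solutions by (simp add: sum_of_bool_eq Int_def conj_commute)
qed

section \<open>Kernel partitions and coherent assignments\<close>

lemma kernel_partition_coherent: "kernel_partition p \<tau> \<in> Coh p"
proof -
  have "P \<subseteq> {..<p} \<times> {..<2} \<times> {0} \<or> P \<subseteq> {..<p} \<times> {..<2} \<times> {1}"
    if P: "P \<in> kernel_partition p \<tau>" for P
  proof -
    obtain x where x: "x \<in> points p" "P = {y \<in> points p. key \<tau> y = key \<tau> x}"
      using P by (auto simp: kernel_partition_def)
    then have "snd (snd x) \<in> {0, 1}" by (auto simp: points_def)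
    moreover have "P \<subseteq> {..<p} \<times> {..<2} \<times> {snd (snd x)}"
      unfolding x(2) by (rule subsetI) (auto simp: key_def points_def)
    ultimately show ?thesis by auto
  qed
  then show ?thesis by (simp add: Coh_def kernel_partition_partition)
qed

lemma kernel_partition_same_class_iff:
  assumes "x \<in> points p" "y \<in> points p"
  shows "(\<exists>P\<in>kernel_partition p \<tau>. x \<in> P \<and> y \<in> P) \<longleftrightarrow> key \<tau> x = key \<tau> y"
  using assms unfolding kernel_partition_def by (simp, metis)

lemma CAs_iff:
  "\<tau> \<in> CAs p \<P> \<longleftrightarrow> \<tau> \<in> assignments p \<and>
     (\<forall>x\<in>points p. \<forall>y\<in>points p. snd (snd x) = snd (snd y) \<longrightarrow>
       (\<tau> x = \<tau> y \<longleftrightarrow> (\<exists>P\<in>\<P>. x \<in> P \<and> y \<in> P)))"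
  unfolding CAs_def Ball_def split_paired_All by simp

lemma CAs_kernel_partition: "\<tau> \<in> assignments p \<Longrightarrow> \<tau> \<in> CAs p (kernel_partition p \<tau>)"
  by (simp add: CAs_iff kernel_partition_same_class_iff key_def)

lemma coherent_same_sequence:
  assumes "\<P> \<in> Coh p" "P \<in> \<P>" "x \<in> P" "y \<in> P"
  shows "snd (snd x) = snd (snd y)"
proof -
  have "P \<subseteq> {..<p} \<times> {..<2} \<times> {0} \<or> P \<subseteq> {..<p} \<times> {..<2} \<times> {1}"
    using assms(1,2) unfolding Coh_def by blast
  then have "P \<subseteq> {z. snd (snd z) = 0} \<or> P \<subseteq> {z. snd (snd z) = 1}" by auto
  then obtain c where c: "P \<subseteq> {z. snd (snd z) = c}" by blast
  show ?thesis using subsetD[OF c assms(3)] subsetD[OF c assms(4)] by simp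
qed

text \<open>A partition is the quotient of its carrier by its same-class relation. Pairs not inside
  A share no class on either side, so agreement on A makes the relations equal as sets.\<close>

lemma partition_on_eqI:
  assumes "partition_on A \<P>" "partition_on A \<Q>"
    and "\<And>x y. x \<in> A \<Longrightarrow> y \<in> A \<Longrightarrow> (\<exists>P\<in>\<P>. x \<in> P \<and> y \<in> P) \<longleftrightarrow> (\<exists>P\<in>\<Q>. x \<in> P \<and> y \<in> P)"
  shows "\<P> = \<Q>"
proof -
  have outside: "x \<in> A \<and> y \<in> A" if "partition_on A \<R>" "\<exists>P\<in>\<R>. x \<in> P \<and> y \<in> P" for \<R> x y
    using that(2) partition_onD1[OF that(1)] by auto
  have "(\<exists>P\<in>\<P>. x \<in> P \<and> y \<in> P) \<longleftrightarrow> (\<exists>P\<in>\<Q>. x \<in> P \<and> y \<in> P)" for x y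
  proof (cases "x \<in> A \<and> y \<in> A")
    case True
    then show ?thesis using assms(3) by simp
  next
    case False
    then show ?thesis using outside[OF assms(1), of x y] outside[OF assms(2), of x y] by argo
  qed
  then have "A // {(x, y). \<exists>P\<in>\<P>. x \<in> P \<and> y \<in> P} = A // {(x, y). \<exists>P\<in>\<Q>. x \<in> P \<and> y \<in> P}"
    by (simp only:)
  then show ?thesis
    by (simp only: partition_on_eq_quotient[OF assms(1)] partition_on_eq_quotient[OF assms(2)])
qed

text \<open>\<open>CAs\<close> constrains only pairs with equal v. For the other pairs both sides
  are false: coherence separates their classes, and their keys differ in the first
  component.\<close>

lemma CAs_same_class_iff:
  assumes "\<P> \<in> Coh p" "\<tau> \<in> CAs p \<P>" "x \<in> points p" "y \<in> points p"
  shows "(\<exists>P\<in>\<P>. x \<in> P \<and> y \<in> P) \<longleftrightarrow> key \<tau> x = key \<tau> y"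
proof (cases "snd (snd x) = snd (snd y)")
  case True
  then show ?thesis using assms(2-4) by (simp add: CAs_iff key_def)
next
  case False
  then show ?thesis using coherent_same_sequence[OF assms(1), of _ x y] unfolding key_def by blast
qed

text \<open>Both partitions have the relation "equal keys" as their same-class relation.
  Consequently distinct coherent partitions have disjoint sets of assignments, so that counts can be
  added.\<close>

lemma CAs_kernel_unique:
  assumes "\<P> \<in> Coh p" "\<tau> \<in> CAs p \<P>"
  shows "\<P> = kernel_partition p \<tau>"
proof (rule partition_on_eqI)
  show "partition_on (points p) \<P>" using assms(1) by (simp add: Coh_def Partitions_def)
  show "partition_on (points p) (kernel_partition p \<tau>)"
    using kernel_partition_partition by (simp add: Partitions_def)
  show "(\<exists>P\<in>\<P>. x \<in> P \<and> y \<in> P) \<longleftrightarrow> (\<exists>P\<in>kernel_partition p \<tau>. x \<in> P \<and> y \<in> P)"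
    if "x \<in> points p" "y \<in> points p" for x y
    using CAs_same_class_iff[OF assms that] kernel_partition_same_class_iff[OF that, of \<tau>] by simp
qed

lemma CAs_eq_len_subset_solutions: "CAs_eq_len p \<P> l \<subseteq> solutions p l"
  by (auto simp: CAs_eq_len_def CAs_eq_def CAs_def assignments_def solutions_def PiE_iff)

lemma finite_CAs_eq_len: "finite (CAs_eq_len p \<P> l)"
  by (rule finite_subset[OF CAs_eq_len_subset_solutions finite_solutions])

lemma finite_CCon: "finite (CCon p)"
  by (rule finite_subset[of _ "Pow (Pow (points p))"])
    (auto simp: CCon_def GELO_def Partitions_def finite_points dest: partition_onD1)

lemma CCon_Coh: "\<P> \<in> CCon p \<Longrightarrow> \<P> \<in> Coh p"
  by (simp add: CCon_def CSat_def)

text \<open>A solution is itself the witness that its kernel is coherently satisfiable, so the GELO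
  condition already puts the kernel in \<open>CCon\<close>. The converse inclusion is uniqueness of
  the kernel.\<close>

lemma GELO_solutions_eq:
  "{\<tau> \<in> solutions p l. kernel_partition p \<tau> \<in> GELO p} = (\<Union>\<P>\<in>CCon p. CAs_eq_len p \<P> l)"
proof (intro equalityI subsetI)
  fix \<tau> assume "\<tau> \<in> {\<tau> \<in> solutions p l. kernel_partition p \<tau> \<in> GELO p}"
  then have \<tau>: "\<tau> \<in> solutions p l" and gelo: "kernel_partition p \<tau> \<in> GELO p" by auto
  then have "\<tau> \<in> CAs_eq_len p (kernel_partition p \<tau>) l"
    using CAs_kernel_partition[of \<tau> p]
    by (auto simp: solutions_def CAs_eq_len_def CAs_eq_def assignments_def PiE_iff)
  moreover have "kernel_partition p \<tau> \<in> CCon p"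
    using gelo calculation kernel_partition_coherent by (auto simp: CCon_def CSat_def CAs_eq_len_def)
  ultimately show "\<tau> \<in> (\<Union>\<P>\<in>CCon p. CAs_eq_len p \<P> l)" by blast
next
  fix \<tau> assume "\<tau> \<in> (\<Union>\<P>\<in>CCon p. CAs_eq_len p \<P> l)"
  then obtain \<P> where P: "\<P> \<in> CCon p" "\<tau> \<in> CAs_eq_len p \<P> l" by blast
  then have "\<P> = kernel_partition p \<tau>"
    by (intro CAs_kernel_unique[OF CCon_Coh]) (auto simp: CAs_eq_len_def CAs_eq_def)
  then show "\<tau> \<in> {\<tau> \<in> solutions p l. kernel_partition p \<tau> \<in> GELO p}"
    using P CAs_eq_len_subset_solutions by (auto simp: CCon_def)
qed

lemma central_moment_eq_sum_CCon:
  "central_moment p l SSCC = (\<Sum>\<P>\<in>CCon p. real (card (CAs_eq_len p \<P> l)))"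
proof -
  have "card (\<Union>\<P>\<in>CCon p. CAs_eq_len p \<P> l) = (\<Sum>\<P>\<in>CCon p. card (CAs_eq_len p \<P> l))"
  proof (rule card_UN_disjoint)
    show "\<forall>\<P>\<in>CCon p. \<forall>\<Q>\<in>CCon p. \<P> \<noteq> \<Q> \<longrightarrow> CAs_eq_len p \<P> l \<inter> CAs_eq_len p \<Q> l = {}"
    proof (intro ballI impI equals0I)
      fix \<P> \<Q> \<tau>
      assume PQ: "\<P> \<in> CCon p" "\<Q> \<in> CCon p" "\<P> \<noteq> \<Q>"
        and "\<tau> \<in> CAs_eq_len p \<P> l \<inter> CAs_eq_len p \<Q> l"
      then have "\<tau> \<in> CAs p \<P>" "\<tau> \<in> CAs p \<Q>" by (auto simp: CAs_eq_len_def CAs_eq_def)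
      then show False
        using CAs_kernel_unique[OF CCon_Coh[OF PQ(1)], of \<tau>]
          CAs_kernel_unique[OF CCon_Coh[OF PQ(2)], of \<tau>] PQ(3)
        by argo
    qed
  qed (auto simp: finite_CCon finite_CAs_eq_len)
  then show ?thesis by (simp add: central_moment_eq_card GELO_solutions_eq)
qed

section \<open>Coherent isomorphism\<close>

lemma carrier_Gamma_iff:
  "(\<phi>, \<sigma>, \<epsilon>) \<in> carrier (Gamma_grp p) \<longleftrightarrow>
     \<phi> permutes {..<2} \<and> \<sigma> \<in> {..<p} \<rightarrow>\<^sub>E {\<pi>. \<pi> permutes {..<2}} \<and> \<epsilon> permutes {..<p}"
  by (simp add: Gamma_grp_def Wreath_def Sym_def DirProd_def)

lemma act_point_in_points:
  assumes "\<gamma> \<in> carrier (Gamma_grp p)" "x \<in> points p"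
  shows "act_point \<gamma> x \<in> points p"
proof -
  obtain \<phi> \<sigma> \<epsilon> where g: "\<gamma> = (\<phi>, \<sigma>, \<epsilon>)" by (cases \<gamma>)
  obtain e s v where x: "x = (e, s, v)" by (cases x)
  have "\<epsilon> e < p" using assms permutes_in_image[of \<epsilon> "{..<p}" e]
    by (auto simp: g x carrier_Gamma_iff points_def)
  moreover have "\<sigma> (\<epsilon> e) permutes {..<2}" using assms calculation
    by (auto simp: g carrier_Gamma_iff)
  ultimately show ?thesis
    using assms permutes_in_image[of \<phi> "{..<2}" v] permutes_in_image[of "\<sigma> (\<epsilon> e)" "{..<2}" s]
    by (auto simp: g x carrier_Gamma_iff points_def)
qed

text \<open>This and the next two laws are claimed only on \<open>points p\<close>: off
  \<open>{..<p}\<close> the tuple \<sigma> is \<open>undefined\<close> and the action is not lawful.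
  The existential form suffices for orbits, which ask only for some group element.\<close>

lemma Gamma_one: "\<exists>\<iota>\<in>carrier (Gamma_grp p). \<forall>x\<in>points p. act_point \<iota> x = x"
proof (intro bexI ballI)
  show "(id, \<lambda>e\<in>{..<p}. id, id) \<in> carrier (Gamma_grp p)"
    by (auto simp: carrier_Gamma_iff permutes_id)
qed (auto simp: points_def)

lemma Gamma_mult:
  assumes "\<gamma> \<in> carrier (Gamma_grp p)" "\<delta> \<in> carrier (Gamma_grp p)"
  shows "\<exists>\<eta>\<in>carrier (Gamma_grp p). \<forall>x\<in>points p. act_point \<eta> x = act_point \<gamma> (act_point \<delta> x)"
proof -
  obtain \<phi> \<sigma> \<epsilon> where g: "\<gamma> = (\<phi>, \<sigma>, \<epsilon>)" by (cases \<gamma>)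
  obtain \<phi>' \<sigma>' \<epsilon>' where d: "\<delta> = (\<phi>', \<sigma>', \<epsilon>')" by (cases \<delta>)
  have \<epsilon>: "\<epsilon> permutes {..<p}" "\<epsilon>' permutes {..<p}"
    using assms by (auto simp: g d carrier_Gamma_iff)
  \<comment> \<open>A point arriving at e under \<epsilon> comes from
    \<open>inv \<epsilon> e\<close>, which is where \<delta> had left it; hence the index of
    \<sigma>'.\<close>
  define \<eta> where "\<eta> = (\<phi> \<circ> \<phi>', (\<lambda>e\<in>{..<p}. \<sigma> e \<circ> \<sigma>' (Hilbert_Choice.inv \<epsilon> e)), \<epsilon> \<circ> \<epsilon>')"
  show ?thesis
  proof (intro bexI ballI)
    show "\<eta> \<in> carrier (Gamma_grp p)"
      using assms permutes_in_image[OF permutes_inv[OF \<epsilon>(1)]]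
      by (auto simp: \<eta>_def g d carrier_Gamma_iff intro!: permutes_compose)
    fix x assume x: "x \<in> points p"
    then show "act_point \<eta> x = act_point \<gamma> (act_point \<delta> x)"
      using permutes_in_image[OF \<epsilon>(1)] permutes_in_image[OF \<epsilon>(2)] permutes_inverses(2)[OF \<epsilon>(1)]
      by (cases x) (auto simp: \<eta>_def g d points_def)
  qed
qed

lemma Gamma_inv:
  assumes "\<gamma> \<in> carrier (Gamma_grp p)"
  shows "\<exists>\<delta>\<in>carrier (Gamma_grp p). \<forall>x\<in>points p. act_point \<delta> (act_point \<gamma> x) = x"
proof -
  obtain \<phi> \<sigma> \<epsilon> where g: "\<gamma> = (\<phi>, \<sigma>, \<epsilon>)" by (cases \<gamma>)
  have \<epsilon>: "\<epsilon> permutes {..<p}" and \<phi>: "\<phi> permutes {..<2}"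
    and \<sigma>: "\<And>e. e < p \<Longrightarrow> \<sigma> e permutes {..<2}"
    using assms by (auto simp: g carrier_Gamma_iff)
  note im = permutes_in_image[OF \<epsilon>] permutes_in_image[OF permutes_inv[OF \<epsilon>]]
  \<comment> \<open>The return move ends at e after starting from \<epsilon> e, so it must undo the
    permutation that \<gamma> used there, the one with index \<epsilon> e.\<close>
  define \<delta> where "\<delta> = (Hilbert_Choice.inv \<phi>, (\<lambda>e\<in>{..<p}. Hilbert_Choice.inv (\<sigma> (\<epsilon> e))),
    Hilbert_Choice.inv \<epsilon>)"
  show ?thesis
  proof (intro bexI ballI)
    show "\<delta> \<in> carrier (Gamma_grp p)"
      using im \<sigma> by (auto simp: \<delta>_def carrier_Gamma_iff intro!: permutes_inv \<epsilon> \<phi>)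
    fix x assume x: "x \<in> points p"
    show "act_point \<delta> (act_point \<gamma> x) = x"
      using x im \<sigma> permutes_inverses[OF \<epsilon>] permutes_inverses[OF \<phi>] permutes_inverses[OF \<sigma>]
      by (cases x) (auto simp: \<delta>_def g points_def)
  qed
qed

lemma inj_on_act_point: "\<gamma> \<in> carrier (Gamma_grp p) \<Longrightarrow> inj_on (act_point \<gamma>) (points p)"
  by (metis Gamma_inv inj_on_inverseI)

lemma act_point_image_points:
  assumes "\<gamma> \<in> carrier (Gamma_grp p)"
  shows "act_point \<gamma> ` points p = points p"
  using act_point_in_points[OF assms] inj_on_act_point[OF assms]
  by (intro endo_inj_surj finite_points) (auto simp del: act_point.simps)

section \<open>The induced action on partitions and its orbits\<close>

lemma Partitions_subset: "\<P> \<in> Partitions p \<Longrightarrow> P \<in> \<P> \<Longrightarrow> P \<subseteq> points p"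
  by (auto simp: Partitions_def dest: partition_onD1)

lemma act_partition_cong:
  assumes "\<P> \<in> Partitions p" "\<And>x. x \<in> points p \<Longrightarrow> act_point \<eta> x = act_point \<gamma> (act_point \<delta> x)"
  shows "act_partition \<eta> \<P> = act_partition \<gamma> (act_partition \<delta> \<P>)"
proof -
  have "act_point \<eta> ` P = act_point \<gamma> ` act_point \<delta> ` P" if "P \<in> \<P>" for P
    unfolding image_image
    using Partitions_subset[OF assms(1) that] by (intro image_cong refl assms(2)) blast
  then show ?thesis unfolding act_partition_def image_image by (rule image_cong[OF refl])
qed

lemma act_partition_id:
  assumes "\<P> \<in> Partitions p" and "\<And>x. x \<in> points p \<Longrightarrow> act_point \<eta> x = x"
  shows "act_partition \<eta> \<P> = \<P>"
proof -
  have "act_point \<eta> ` P = P" if "P \<in> \<P>" for P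
  proof -
    have "act_point \<eta> ` P = (\<lambda>x. x) ` P"
      using Partitions_subset[OF assms(1) that] by (intro image_cong refl assms(2)) blast
    then show ?thesis by simp
  qed
  then show ?thesis by (simp add: act_partition_def)
qed

lemma act_partition_Partitions:
  assumes "\<gamma> \<in> carrier (Gamma_grp p)" "\<P> \<in> Partitions p"
  shows "act_partition \<gamma> \<P> \<in> Partitions p"
proof -
  have "partition_on (act_point \<gamma> ` points p) ((`) (act_point \<gamma>) ` \<P> - {{}})"
    using assms(2) inj_on_act_point[OF assms(1)]
    by (intro partition_on_inj_image) (simp_all add: Partitions_def)
  \<comment> \<open>Images of nonempty classes are nonempty, so the deletion of the empty set above
    removes nothing.\<close>
  moreover have "{} \<notin> (`) (act_point \<gamma>) ` \<P>"
  proof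
    assume "{} \<in> (`) (act_point \<gamma>) ` \<P>"
    then have "{} \<in> \<P>" by (metis (no_types) image_iff image_is_empty)
    then show False using assms(2) by (simp add: Partitions_def partition_onD3)
  qed
  ultimately show ?thesis
    by (simp add: act_point_image_points[OF assms(1)] Partitions_def act_partition_def)
qed

lemma act_partition_inv:
  assumes "\<gamma> \<in> carrier (Gamma_grp p)" "\<P> \<in> Partitions p"
  obtains \<delta> where "\<delta> \<in> carrier (Gamma_grp p)" "act_partition \<delta> (act_partition \<gamma> \<P>) = \<P>"
proof -
  obtain \<delta> where d: "\<delta> \<in> carrier (Gamma_grp p)"
    "\<forall>x\<in>points p. act_point \<delta> (act_point \<gamma> x) = x"
    using Gamma_inv[OF assms(1)] by blast
  \<comment> \<open>With an identity element as the composite, cancellation becomes an instance of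
    \<open>act_partition_cong\<close>.\<close>
  obtain \<iota> where i: "\<iota> \<in> carrier (Gamma_grp p)" "\<forall>x\<in>points p. act_point \<iota> x = x"
    using Gamma_one by blast
  have "act_partition \<delta> (act_partition \<gamma> \<P>) = act_partition \<iota> \<P>"
    by (rule act_partition_cong[OF assms(2), symmetric]) (simp add: d(2) i(2) del: act_point.simps)
  also have "\<dots> = \<P>" by (rule act_partition_id[OF assms(2) i(2)[rule_format]])
  finally show ?thesis by (rule that[OF d(1)])
qed

lemma orbit_self:
  assumes "\<P> \<in> Partitions p"
  shows "\<P> \<in> orbit (Gamma_grp p) act_partition \<P>"
proof -
  obtain \<iota> where i: "\<iota> \<in> carrier (Gamma_grp p)" "\<forall>x\<in>points p. act_point \<iota> x = x"
    using Gamma_one by blast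
  show ?thesis
    unfolding orbit_def
    by (intro CollectI exI[of _ \<iota>] conjI i(1) act_partition_id[OF assms i(2)[rule_format], symmetric])
qed

lemma orbit_act_subset:
  assumes "\<gamma> \<in> carrier (Gamma_grp p)" "\<P> \<in> Partitions p"
  shows "orbit (Gamma_grp p) act_partition (act_partition \<gamma> \<P>) \<subseteq>
         orbit (Gamma_grp p) act_partition \<P>"
proof
  fix \<Q> assume "\<Q> \<in> orbit (Gamma_grp p) act_partition (act_partition \<gamma> \<P>)"
  then obtain \<delta> where d: "\<delta> \<in> carrier (Gamma_grp p)" "\<Q> = act_partition \<delta> (act_partition \<gamma> \<P>)"
    by (auto simp: orbit_def)
  obtain \<eta> where e: "\<eta> \<in> carrier (Gamma_grp p)"
    "\<forall>x\<in>points p. act_point \<eta> x = act_point \<delta> (act_point \<gamma> x)"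
    using Gamma_mult[OF d(1) assms(1)] by blast
  have "\<Q> = act_partition \<eta> \<P>"
    using act_partition_cong[OF assms(2) e(2)[rule_format]] unfolding d(2) by (rule sym)
  then show "\<Q> \<in> orbit (Gamma_grp p) act_partition \<P>"
    unfolding orbit_def using e(1) by blast
qed

text \<open>The reverse inclusion is \<open>orbit_act_subset\<close> again, applied to the moved
  partition and an element that moves it back.\<close>

lemma orbit_act:
  assumes "\<gamma> \<in> carrier (Gamma_grp p)" "\<P> \<in> Partitions p"
  shows "orbit (Gamma_grp p) act_partition (act_partition \<gamma> \<P>) =
         orbit (Gamma_grp p) act_partition \<P>"
proof -
  obtain \<delta> where "\<delta> \<in> carrier (Gamma_grp p)" "act_partition \<delta> (act_partition \<gamma> \<P>) = \<P>"
    using act_partition_inv[OF assms] .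
  then show ?thesis
    using orbit_act_subset[OF assms] orbit_act_subset[OF _ act_partition_Partitions[OF assms], of \<delta>]
    by (intro subset_antisym) simp_all
qed

section \<open>Transport of solutions along the action\<close>

definition pull :: "nat \<Rightarrow> gamma \<Rightarrow> (point \<Rightarrow> nat) \<Rightarrow> point \<Rightarrow> nat" where
  "pull p \<gamma> \<tau> = (\<lambda>x\<in>points p. \<tau> (act_point \<gamma> x))"

text \<open>Since \<gamma> maps \<open>points p\<close> onto itself, the pullback records every
  value of \<tau> there, and extensionality fixes the rest.\<close>

lemma inj_on_pull:
  assumes "\<gamma> \<in> carrier (Gamma_grp p)"
  shows "inj_on (pull p \<gamma>) (assignments p)"
proof (rule inj_onI)
  fix \<tau> \<tau>' assume a: "\<tau> \<in> assignments p" "\<tau>' \<in> assignments p" "pull p \<gamma> \<tau> = pull p \<gamma> \<tau>'"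
  have "\<tau> (act_point \<gamma> x) = \<tau>' (act_point \<gamma> x)" if "x \<in> points p" for x
    using fun_cong[OF a(3), of x] that by (simp add: pull_def)
  then have "\<tau> y = \<tau>' y" if "y \<in> points p" for y
    using that act_point_image_points[OF assms] by (metis image_iff)
  then show "\<tau> = \<tau>'"
    using a by (intro extensionalityI[of _ "points p"]) (auto simp: assignments_def PiE_def)
qed

lemma act_point_sequence:
  assumes "\<gamma> \<in> carrier (Gamma_grp p)"
  shows "snd (snd (act_point \<gamma> x)) = snd (snd (act_point \<gamma> y)) \<longleftrightarrow> snd (snd x) = snd (snd y)"
proof -
  obtain \<phi> \<sigma> \<epsilon> where g: "\<gamma> = (\<phi>, \<sigma>, \<epsilon>)" by (cases \<gamma>)
  then have "inj \<phi>" using assms by (auto simp: carrier_Gamma_iff intro: permutes_inj)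
  moreover have "snd (snd (act_point \<gamma> z)) = \<phi> (snd (snd z))" for z
    by (cases z) (simp add: g)
  ultimately show ?thesis by (simp add: inj_eq)
qed

lemma permutes_2: "\<pi> permutes {..<2::nat} \<Longrightarrow> \<pi> 0 = 0 \<and> \<pi> 1 = 1 \<or> \<pi> 0 = 1 \<and> \<pi> 1 = 0"
  using permutes_in_image[of \<pi> "{..<2}" 0] permutes_in_image[of \<pi> "{..<2}" 1]
    permutes_inj[of \<pi> "{..<2}", THEN injD, of 0 1]
  by (auto simp: less_2_cases_iff)

text \<open>Each component preserves the system: \<epsilon> renames equations, \<sigma> may exchange
  the two sides of one, and \<phi> may exchange the summands on both sides.\<close>

lemma pull_equations:
  assumes "\<gamma> \<in> carrier (Gamma_grp p)" "e < p"
    and eq: "\<And>e. e < p \<Longrightarrow> \<tau> (e, 0, 0) + \<tau> (e, 0, 1) = \<tau> (e, 1, 0) + \<tau> (e, 1, 1)"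
  shows "pull p \<gamma> \<tau> (e, 0, 0) + pull p \<gamma> \<tau> (e, 0, 1) = pull p \<gamma> \<tau> (e, 1, 0) + pull p \<gamma> \<tau> (e, 1, 1)"
proof -
  obtain \<phi> \<sigma> \<epsilon> where g: "\<gamma> = (\<phi>, \<sigma>, \<epsilon>)" by (cases \<gamma>)
  have e: "\<epsilon> e < p" using assms permutes_in_image[of \<epsilon> "{..<p}" e]
    by (auto simp: g carrier_Gamma_iff)
  have "\<phi> permutes {..<2}" "\<sigma> (\<epsilon> e) permutes {..<2}"
    using assms e by (auto simp: g carrier_Gamma_iff)
  from permutes_2[OF this(1)] permutes_2[OF this(2)] show ?thesis
    using eq[OF e] \<open>e < p\<close> by (auto simp: pull_def g points_def)
qed

lemma act_partition_same_class:
  assumes "\<gamma> \<in> carrier (Gamma_grp p)" "\<P> \<in> Partitions p" "x \<in> points p" "y \<in> points p"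
  shows "(\<exists>Q\<in>act_partition \<gamma> \<P>. act_point \<gamma> x \<in> Q \<and> act_point \<gamma> y \<in> Q) \<longleftrightarrow>
         (\<exists>P\<in>\<P>. x \<in> P \<and> y \<in> P)"
proof -
  have "act_point \<gamma> z \<in> act_point \<gamma> ` P \<longleftrightarrow> z \<in> P" if "P \<in> \<P>" "z \<in> points p" for P z
    using that Partitions_subset[OF assms(2)]
    by (intro inj_on_image_mem_iff[OF inj_on_act_point[OF assms(1)]])
  then show ?thesis using assms(3,4) by (auto simp: act_partition_def)
qed

text \<open>Pulling back is contravariant: it leads from solutions for the moved partition to
  solutions for the original one. The restriction to equal v survives because \<phi> is
  injective.\<close>

lemma pull_CAs_eq:
  assumes g: "\<gamma> \<in> carrier (Gamma_grp p)" and P: "\<P> \<in> Partitions p"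
    and \<tau>: "\<tau> \<in> CAs_eq p (act_partition \<gamma> \<P>)"
  shows "pull p \<gamma> \<tau> \<in> CAs_eq p \<P>"
proof -
  have C: "\<tau> x = \<tau> y \<longleftrightarrow> (\<exists>Q\<in>act_partition \<gamma> \<P>. x \<in> Q \<and> y \<in> Q)"
    if "x \<in> points p" "y \<in> points p" "snd (snd x) = snd (snd y)" for x y
    using \<tau> that unfolding CAs_eq_def CAs_iff by blast
  have "pull p \<gamma> \<tau> x = pull p \<gamma> \<tau> y \<longleftrightarrow> (\<exists>P\<in>\<P>. x \<in> P \<and> y \<in> P)"
    if "x \<in> points p" "y \<in> points p" "snd (snd x) = snd (snd y)" for x y
    using C[of "act_point \<gamma> x" "act_point \<gamma> y"] that act_point_in_points[OF g]
      act_point_sequence[OF g] act_partition_same_class[OF g P] by (simp add: pull_def)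
  then have "pull p \<gamma> \<tau> \<in> CAs p \<P>"
    by (simp add: CAs_iff assignments_def pull_def)
  then show ?thesis
    using pull_equations[OF g, of _ \<tau>] \<tau> by (simp add: CAs_eq_def)
qed

lemma card_CAs_eq_len_act_le:
  assumes g: "\<gamma> \<in> carrier (Gamma_grp p)" and P: "\<P> \<in> Partitions p"
  shows "card (CAs_eq_len p (act_partition \<gamma> \<P>) l) \<le> card (CAs_eq_len p \<P> l)"
proof (rule card_inj_on_le[where f = "pull p \<gamma>"])
  show "inj_on (pull p \<gamma>) (CAs_eq_len p (act_partition \<gamma> \<P>) l)"
    by (rule inj_on_subset[OF inj_on_pull[OF g]]) (auto simp: CAs_eq_len_def CAs_eq_def CAs_def)
  show "pull p \<gamma> ` CAs_eq_len p (act_partition \<gamma> \<P>) l \<subseteq> CAs_eq_len p \<P> l"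
    using pull_CAs_eq[OF g P] act_point_in_points[OF g] by (auto simp: CAs_eq_len_def pull_def)
qed (rule finite_CAs_eq_len)

text \<open>Injectivity of the pullback gives one inequality; the same inequality for an element
  that moves the partition back gives the other.\<close>

lemma card_CAs_eq_len_act:
  assumes g: "\<gamma> \<in> carrier (Gamma_grp p)" and P: "\<P> \<in> Partitions p"
  shows "card (CAs_eq_len p (act_partition \<gamma> \<P>) l) = card (CAs_eq_len p \<P> l)"
proof -
  obtain \<delta> where "\<delta> \<in> carrier (Gamma_grp p)" "act_partition \<delta> (act_partition \<gamma> \<P>) = \<P>"
    using act_partition_inv[OF assms] .
  then show ?thesis
    using card_CAs_eq_len_act_le[OF g P, of l]
      card_CAs_eq_len_act_le[OF _ act_partition_Partitions[OF g P], of \<delta> l] by simp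
qed

section \<open>Invariance of \<open>CCon\<close> under the action\<close>

lemma CohI:
  assumes part: "\<P> \<in> Partitions p"
    and same: "\<And>P x y. P \<in> \<P> \<Longrightarrow> x \<in> P \<Longrightarrow> y \<in> P \<Longrightarrow> snd (snd x) = snd (snd y)"
  shows "\<P> \<in> Coh p"
proof -
  have "P \<subseteq> {..<p} \<times> {..<2} \<times> {0} \<or> P \<subseteq> {..<p} \<times> {..<2} \<times> {1}" if P: "P \<in> \<P>" for P
  proof -
    \<comment> \<open>A class has some member x, and the last coordinate of x decides which half
      contains the class.\<close>
    have "{} \<notin> \<P>" using part by (simp add: Partitions_def partition_onD3)
    then obtain x where x: "x \<in> P" using P by (metis ex_in_conv)
    have sub: "y \<in> points p" if "y \<in> P" for y
      using subsetD[OF Partitions_subset[OF part P] that] .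
    have "P \<subseteq> {..<p} \<times> {..<2} \<times> {snd (snd x)}"
    proof
      fix y assume "y \<in> P"
      then show "y \<in> {..<p} \<times> {..<2} \<times> {snd (snd x)}"
        using sub[of y] same[OF P, of y x] x by (simp add: points_def mem_Times_iff)
    qed
    moreover have "snd (snd x) = 0 \<or> snd (snd x) = 1"
      using sub[OF x] by (auto simp: points_def)
    ultimately show ?thesis by metis
  qed
  then show ?thesis using part by (simp add: Coh_def)
qed

lemma act_partition_Coh:
  assumes g: "\<gamma> \<in> carrier (Gamma_grp p)" and P: "\<P> \<in> Coh p"
  shows "act_partition \<gamma> \<P> \<in> Coh p"
proof (rule CohI)
  show "act_partition \<gamma> \<P> \<in> Partitions p"
    using P by (intro act_partition_Partitions[OF g]) (simp add: Coh_def)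
  fix Q x y assume Q: "Q \<in> act_partition \<gamma> \<P>" "x \<in> Q" "y \<in> Q"
  obtain R where R: "R \<in> \<P>" "Q = act_point \<gamma> ` R"
    using Q(1) unfolding act_partition_def by (rule imageE)
  obtain x' where x': "x' \<in> R" "x = act_point \<gamma> x'" using Q(2) unfolding R(2) by (rule imageE)
  obtain y' where y': "y' \<in> R" "y = act_point \<gamma> y'" using Q(3) unfolding R(2) by (rule imageE)
  show "snd (snd x) = snd (snd y)"
    unfolding x'(2) y'(2) act_point_sequence[OF g]
    by (rule coherent_same_sequence[OF P R(1) x'(1) y'(1)])
qed

lemma act_partition_CSat:
  assumes g: "\<gamma> \<in> carrier (Gamma_grp p)" and P: "\<P> \<in> CSat p"
  shows "act_partition \<gamma> \<P> \<in> CSat p"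
proof -
  have coh: "\<P> \<in> Coh p" and part: "\<P> \<in> Partitions p" using P by (simp_all add: CSat_def Coh_def)
  obtain \<delta> where d: "\<delta> \<in> carrier (Gamma_grp p)" "act_partition \<delta> (act_partition \<gamma> \<P>) = \<P>"
    using act_partition_inv[OF g part] .
  obtain \<tau> where \<tau>: "\<tau> \<in> CAs_eq p \<P>" using P by (auto simp: CSat_def)
  \<comment> \<open>By contravariance, a solution for the moved partition comes from pulling back
    along \<delta>, not along \<gamma>.\<close>
  have "pull p \<delta> \<tau> \<in> CAs_eq p (act_partition \<gamma> \<P>)"
    by (rule pull_CAs_eq[OF d(1) act_partition_Partitions[OF g part]]) (simp only: d(2) \<tau>)
  then have "CAs_eq p (act_partition \<gamma> \<P>) \<noteq> {}" by (metis empty_iff)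
  then show ?thesis using act_partition_Coh[OF g coh] by (simp add: CSat_def)
qed

text \<open>Class sizes are preserved by injectivity, and block d is carried onto block \<epsilon>
  d. An odd trace on block e is thus the image of an odd trace on the block that \<epsilon> sends to
  e.\<close>

lemma act_partition_GELO:
  assumes g: "\<gamma> \<in> carrier (Gamma_grp p)" and P: "\<P> \<in> GELO p"
  shows "act_partition \<gamma> \<P> \<in> GELO p"
proof -
  have part: "\<P> \<in> Partitions p" using P by (simp add: GELO_def)
  note sub = Partitions_subset[OF part]
  have card_act: "card (act_point \<gamma> ` Q) = card Q" if "Q \<subseteq> points p" for Q
    using inj_on_subset[OF inj_on_act_point[OF g] that] by (rule card_image)
  obtain \<phi> \<sigma> \<epsilon> where g': "\<gamma> = (\<phi>, \<sigma>, \<epsilon>)" by (cases \<gamma>)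
  then have \<epsilon>: "\<epsilon> permutes {..<p}" using g by (simp add: carrier_Gamma_iff)
  have fst_act: "fst (act_point \<gamma> x) = \<epsilon> (fst x)" for x by (cases x) (simp add: g')
  have mem_block: "x \<in> {e} \<times> sides \<longleftrightarrow> fst x = e" if "x \<in> points p" for x e
    using that by (simp add: points_def mem_Times_iff)
  have "even_partition (act_partition \<gamma> \<P>)"
    unfolding even_partition_def act_partition_def
  proof
    fix Q assume "Q \<in> (`) (act_point \<gamma>) ` \<P>"
    then obtain R where R: "R \<in> \<P>" "Q = act_point \<gamma> ` R" by (rule imageE)
    have "finite R \<and> even (card R)" using P R(1) by (simp add: GELO_def even_partition_def)
    then show "finite Q \<and> even (card Q)" unfolding R(2) by (simp add: card_act[OF sub[OF R(1)]])
  qed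
  moreover have "\<not> even_partition (restrict_partition (act_partition \<gamma> \<P>) e)" if "e < p" for e
  proof -
    have "e \<in> \<epsilon> ` {..<p}" using that by (simp add: permutes_image[OF \<epsilon>])
    then obtain d where d: "d < p" "e = \<epsilon> d" by auto
    then obtain Q where Q: "Q \<in> \<P>" "odd (card (Q \<inter> ({d} \<times> sides)))"
      using P unfolding GELO_def even_restrict_partition_iff by blast
    have "act_point \<gamma> ` Q \<inter> ({e} \<times> sides) = act_point \<gamma> ` (Q \<inter> ({d} \<times> sides))"
    proof (intro equalityI subsetI)
      fix z assume z: "z \<in> act_point \<gamma> ` Q \<inter> ({e} \<times> sides)"
      obtain x where x: "x \<in> Q" "z = act_point \<gamma> x" using IntD1[OF z] by (rule imageE)
      have "x \<in> points p" using sub[OF Q(1)] x(1) by (rule subsetD)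
      moreover have "\<epsilon> (fst x) = \<epsilon> d" using IntD2[OF z] d(2) fst_act[of x] x(2) by (simp add: mem_Times_iff)
      then have "fst x = d" using permutes_inj[OF \<epsilon>] by (simp add: inj_eq)
      ultimately show "z \<in> act_point \<gamma> ` (Q \<inter> ({d} \<times> sides))"
        unfolding x(2) using x(1) mem_block by (intro imageI IntI) simp_all
    next
      fix z assume "z \<in> act_point \<gamma> ` (Q \<inter> ({d} \<times> sides))"
      then obtain x where "x \<in> Q \<inter> ({d} \<times> sides)" and z: "z = act_point \<gamma> x" by (rule imageE)
      then have x: "x \<in> Q" "x \<in> {d} \<times> sides" by simp_all
      have "x \<in> points p" using sub[OF Q(1)] x(1) by (rule subsetD)
      then have "z \<in> points p" unfolding z by (rule act_point_in_points[OF g])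
      moreover have "fst z = e" using x(2) d(2) fst_act[of x] z by (simp add: mem_Times_iff)
      ultimately show "z \<in> act_point \<gamma> ` Q \<inter> ({e} \<times> sides)"
        unfolding z using x(1) mem_block by (intro imageI IntI) simp_all
    qed
    moreover have "Q \<inter> ({d} \<times> sides) \<subseteq> points p" using sub[OF Q(1)] by blast
    ultimately have "odd (card (act_point \<gamma> ` Q \<inter> ({e} \<times> sides)))"
      using Q(2) card_act by simp
    then show ?thesis
      unfolding even_restrict_partition_iff act_partition_def using Q(1) by blast
  qed
  ultimately show ?thesis using act_partition_Partitions[OF g part] by (simp add: GELO_def)
qed

lemma act_partition_CCon:
  "\<gamma> \<in> carrier (Gamma_grp p) \<Longrightarrow> \<P> \<in> CCon p \<Longrightarrow> act_partition \<gamma> \<P> \<in> CCon p"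
  by (simp add: CCon_def act_partition_CSat act_partition_GELO)

section \<open>Summation over orbits\<close>

lemma CSols_eq:
  assumes "\<PP> \<in> CIsom p" "\<P> \<in> \<PP>"
  shows "CSols p \<PP> l = card (CAs_eq_len p \<P> l)"
proof -
  obtain \<Q> where Q: "\<Q> \<in> CCon p" "\<PP> = orbit (Gamma_grp p) act_partition \<Q>"
    using assms(1) by (auto simp: CIsom_def)
  have part: "\<Q> \<in> Partitions p" using CCon_Coh[OF Q(1)] by (simp add: Coh_def)
  have "card (CAs_eq_len p \<R> l) = card (CAs_eq_len p \<Q> l)" if R: "\<R> \<in> \<PP>" for \<R>
  proof -
    obtain \<gamma> where g: "\<gamma> \<in> carrier (Gamma_grp p)" and \<R>: "\<R> = act_partition \<gamma> \<Q>"
      using R unfolding Q(2) orbit_def by blast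
    show ?thesis unfolding \<R> by (rule card_CAs_eq_len_act[OF g part])
  qed
  then have "\<forall>\<R>\<in>\<PP>. card (CAs_eq_len p \<R> l) = card (CAs_eq_len p \<P> l)"
    using assms(2) by simp
  \<comment> \<open>The count is constant on the orbit, and \<P> shows that the orbit is inhabited;
    over an empty class every n would satisfy the description.\<close>
  then show ?thesis
    unfolding CSols_def using assms(2) by (intro the_equality) (assumption, metis)
qed

theorem proposition4p15:
  fixes p l :: nat
  shows "central_moment p l SSCC = (\<Sum>\<PP>\<in>CIsom p. real (card \<PP>) * real (CSols p \<PP> l))"
proof -
  let ?orb = "orbit (Gamma_grp p) act_partition"
  have part: "\<P> \<in> Partitions p" if "\<P> \<in> CCon p" for \<P>
    using that by (simp add: CCon_def GELO_def)
  \<comment> \<open>\<open>CCon\<close> is closed under the action and orbits are disjoint, so the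
    partitions with orbit \<PP> are precisely the members of \<PP>. This turns the size of a fibre
    into \<open>card \<PP>\<close>.\<close>
  have fibre: "{\<P> \<in> CCon p. ?orb \<P> = \<PP>} = \<PP>" if "\<PP> \<in> CIsom p" for \<PP>
  proof -
    obtain \<Q> where Q: "\<Q> \<in> CCon p" "\<PP> = ?orb \<Q>" using \<open>\<PP> \<in> CIsom p\<close> by (auto simp: CIsom_def)
    have "\<P> \<in> CCon p \<and> ?orb \<P> = \<PP>" if P: "\<P> \<in> \<PP>" for \<P>
    proof -
      obtain \<gamma> where g: "\<gamma> \<in> carrier (Gamma_grp p)" and \<P>: "\<P> = act_partition \<gamma> \<Q>"
        using P unfolding Q(2) orbit_def by blast
      show ?thesis
        unfolding \<P> Q(2) using act_partition_CCon[OF g Q(1)] orbit_act[OF g part[OF Q(1)]] ..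
    qed
    moreover have "\<P> \<in> ?orb \<P>" if "\<P> \<in> CCon p" for \<P>
      using part[OF that] by (rule orbit_self)
    ultimately show ?thesis by blast
  qed
  have "central_moment p l SSCC =
        (\<Sum>\<PP>\<in>CIsom p. \<Sum>\<P>\<in>{\<P> \<in> CCon p. ?orb \<P> = \<PP>}. real (card (CAs_eq_len p \<P> l)))"
    unfolding central_moment_eq_sum_CCon CIsom_def by (rule sum.image_gen[OF finite_CCon])
  also have "\<dots> = (\<Sum>\<PP>\<in>CIsom p. real (card \<PP>) * real (CSols p \<PP> l))"
  proof (rule sum.cong[OF refl])
    fix \<PP> assume PP: "\<PP> \<in> CIsom p"
    have "(\<Sum>\<P>\<in>\<PP>. real (card (CAs_eq_len p \<P> l))) = (\<Sum>\<P>\<in>\<PP>. real (CSols p \<PP> l))"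
      by (rule sum.cong[OF refl]) (simp only: CSols_eq[OF PP])
    then show "(\<Sum>\<P>\<in>{\<P> \<in> CCon p. ?orb \<P> = \<PP>}. real (card (CAs_eq_len p \<P> l))) =
        real (card \<PP>) * real (CSols p \<PP> l)"
      unfolding fibre[OF PP] by simp
  qed
  finally show ?thesis .
qed

end
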